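(* Let $P\in\mathbb{C}[z]$ be a non-constant polynomial all of whose zeros are distinct (simple). Then $P$ is a strong uniqueness polynomial for $L$-functions of positive degree in $\mathcal{S}^{\#}$ with $a(1)=1$; that is, if $\mathcal{L}_1$ and $\mathcal{L}_2$ are non-constant $L$-functions in the extended Selberg class $\mathcal{S}^{\#}$, each of positive degree and each with first Dirichlet coefficient $a(1)=1$, and if $P(\mathcal{L}_1)=c\,P(\mathcal{L}_2)$ for some non-zero constant $c\in\mathbb{C}$, then $\mathcal{L}_1=\mathcal{L}_2$.
   Context: The extended Selberg class $\mathcal{S}^{\#}$ consists of the not identically vanishing Dirichlet series $\mathcal{L}(s)=\sum_{n=1}^{\infty}a(n)n^{-s}$ such that: (i) the series converges absolutely for $\Re(s)>1$; (ii) (analytic continuation) there is an integer $k\ge 0$ such that $(s-1)^k\mathcal{L}(s)$ extends to an entire function of finite order; (iii) (functional equation) there are an integer $K\ge 0$, reals $Q>0$, $\lambda_j>0$, complex numbers $\nu_j$ with $\Re(\nu_j)\ge 0$ ($1\le j\le K$) and $\omega\in\mathbb{C}$ with $|\omega|=1$ such that $\Lambda(s)=\omega\,\overline{\Lambda(1-\overline{s})}$, where $\Lambda(s)=\mathcal{L}(s)Q^s\prod_{j=1}^{K}\Gamma(\lambda_j s+\nu_j)$. The degree of $\mathcal{L}$ is $d_{\mathcal{L}}=2\sum_{j=1}^{K}\lambda_j$ (so $d_{\mathcal{L}}=0$ iff $K=0$); it depends only on $\mathcal{L}$. "$L$-function" means an element of $\mathcal{S}^{\#}$, regarded as a meromorphic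 function on $\mathbb{C}$ (with at most a pole at $s=1$). *)

theory Defs
  imports "HOL-Complex_Analysis.Complex_Analysis"
begin

definition finite_order :: "(complex \<Rightarrow> complex) \<Rightarrow> bool" where
  "finite_order f \<longleftrightarrow>
     (\<exists>(\<rho>::real) (R::real). \<forall>z. norm z \<ge> R \<longrightarrow> norm (f z) \<le> exp (norm z powr \<rho>))"

definition dirichlet_term :: "(nat \<Rightarrow> complex) \<Rightarrow> complex \<Rightarrow> nat \<Rightarrow> complex" where
  "dirichlet_term a s n = a n * of_nat n powr (- s)"

definition completed_L ::
  "(complex \<Rightarrow> complex) \<Rightarrow> nat \<Rightarrow> real \<Rightarrow> (nat \<Rightarrow> real) \<Rightarrow> (nat \<Rightarrow> complex) \<Rightarrow> complex \<Rightarrow> complex" where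
  "completed_L L K Q lam nu s =
     L s * of_real Q powr s * (\<Prod>j=1..K. Gamma (of_real (lam j) * s + nu j))"

text \<open>
  The functional equation is an identity of meromorphic functions.  In the library, \<^const>\<open>Gamma\<close>
  takes the value 0 at its poles, so the identity is required only off a set without accumulation
  points in the plane; a pointwise identity at every point would be wrong at the poles of the
  Gamma factors.
\<close>
definition functional_equation ::
  "(complex \<Rightarrow> complex) \<Rightarrow> nat \<Rightarrow> real \<Rightarrow> (nat \<Rightarrow> real) \<Rightarrow> (nat \<Rightarrow> complex) \<Rightarrow> complex \<Rightarrow> bool" where
  "functional_equation L K Q lam nu \<omega> \<longleftrightarrow>
     Q > 0 \<and> (\<forall>j\<in>{1..K}. lam j > 0 \<and> Re (nu j) \<ge> 0) \<and> norm \<omega> = 1 \<and>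
     (\<forall>\<^sub>\<approx>s\<in>UNIV. completed_L L K Q lam nu s = \<omega> * cnj (completed_L L K Q lam nu (1 - cnj s)))"

text \<open>
  Here L is the meromorphic function on the whole plane and a is its sequence of Dirichlet
  coefficients, of which only the values at positive indices matter.  The condition
  \<^const>\<open>nicely_meromorphic_on\<close> fixes the value of L at \<open>s = 1\<close>: the continuous one if there is no
  pole, and 0 by convention if there is one.  Hence equality of such functions in the sense of HOL
  is equality as meromorphic functions.
\<close>
definition extended_selberg :: "(nat \<Rightarrow> complex) \<Rightarrow> (complex \<Rightarrow> complex) \<Rightarrow> bool" where
  "extended_selberg a L \<longleftrightarrow>
     L nicely_meromorphic_on UNIV \<and>
     (\<exists>s. Re s > 1 \<and> L s \<noteq> 0) \<and>
     (\<forall>s. Re s > 1 \<longrightarrow>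
        summable (\<lambda>n. norm (dirichlet_term a s (Suc n))) \<and>
        L s = (\<Sum>n. dirichlet_term a s (Suc n))) \<and>
     (\<exists>(k::nat) F. F holomorphic_on UNIV \<and> finite_order F \<and>
        (\<forall>s. s \<noteq> 1 \<longrightarrow> F s = (s - 1) ^ k * L s)) \<and>
     (\<exists>K Q lam nu \<omega>. functional_equation L K Q lam nu \<omega>)"

text \<open>The degree does not depend on the choice of the functional equation, whence the description.\<close>
definition L_degree :: "(complex \<Rightarrow> complex) \<Rightarrow> real" where
  "L_degree L = (THE d. \<exists>K Q lam nu \<omega>. functional_equation L K Q lam nu \<omega> \<and>
                                        d = 2 * (\<Sum>j=1..K. lam j))"

end

theory Submission
  imports Defs
begin

text \<open>
  On a vertical line far to the left the functional equation forces both L-functions to tend to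
  infinity, so that comparing leading terms in \<open>P(L1) = c P(L2)\<close> gives \<open>(L1/L2)^n \<rightarrow> c\<close> with
  \<open>n = deg P\<close>.  Reflecting to the right half-plane multiplies \<open>(L1/L2)^n\<close> by quotients of Gamma
  factors.  These disappear under the multiplicative second difference
  \<open>f(w+2) f(w) / f(w+1)^2\<close>, since \<open>Gamma(z+a+b) Gamma(z) / (Gamma(z+a) Gamma(z+b)) \<rightarrow> 1\<close>
  as \<open>Im z \<rightarrow> \<infinity>\<close>.  Hence the second difference of \<open>G = (L1/L2)^n\<close> tends to 1 upwards along
  vertical lines, and by almost periodicity of Dirichlet series it is identically 1 in a right
  half-plane.  As \<open>G \<rightarrow> 1\<close> for \<open>Re w \<rightarrow> \<infinity>\<close>, this gives \<open>G = 1\<close>; so \<open>L1/L2\<close> is a constant root of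
  unity, and the constant is 1 because \<open>a(1) = 1\<close>.
\<close>

section \<open>The Gamma function on vertical lines\<close>

text \<open>In the Gauss product for Gamma(z+a+b) Gamma(z) / (Gamma(z+a) Gamma(z+b)) the k-th factor
  is (z+a+k)(z+b+k) / ((z+k)(z+a+b+k)). Numerator and denominator differ by ab, so this term is the
  factor minus 1.\<close>

definition gamma_defect :: "real \<Rightarrow> real \<Rightarrow> complex \<Rightarrow> nat \<Rightarrow> complex" where
  "gamma_defect a b z k = of_real (a * b) / ((z + of_nat k) * (z + of_real (a + b) + of_nat k))"

text \<open>Write k + 1 = (Re z + k) + (1 - Re z); the second summand is absorbed because the norm
  is at least Im z \<ge> 1. The constant depends on Re z alone, so it is uniform along the upper
  part of a vertical line.\<close>

lemma Suc_le_norm_add_nat: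
  fixes z :: complex
  assumes "Im z \<ge> 1"
  shows "real (Suc k) \<le> (1 + \<bar>1 - Re z\<bar>) * norm (z + of_nat k)"
proof -
  have "1 \<le> norm (z + of_nat k)"
    using abs_Im_le_cmod[of "z + of_nat k"] assms by simp
  then have "\<bar>1 - Re z\<bar> \<le> \<bar>1 - Re z\<bar> * norm (z + of_nat k)"
    by (simp add: mult_le_cancel_left1)
  moreover have "Re z + real k \<le> norm (z + of_nat k)"
    using complex_Re_le_cmod[of "z + of_nat k"] by simp
  ultimately show ?thesis
    by (simp add: algebra_simps)
qed

text \<open>Supplies a summable majorant that does not change along a vertical line.\<close>

lemma gamma_defect_bound:
  assumes "Im z \<ge> 1"
  shows "norm (gamma_defect a b z k)
    \<le> \<bar>a * b\<bar> * (1 + \<bar>1 - Re z\<bar>) * (1 + \<bar>1 - (Re z + (a + b))\<bar>) * inverse (real (Suc k) ^ 2)"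
proof -
  let ?A = "1 + \<bar>1 - Re z\<bar>" and ?B = "1 + \<bar>1 - (Re z + (a + b))\<bar>"
  let ?p = "norm (z + of_nat k)" and ?q = "norm (z + of_real (a + b) + of_nat k)"
  have "real (Suc k) \<le> ?A * ?p" "real (Suc k) \<le> ?B * ?q"
    using Suc_le_norm_add_nat[of z k] Suc_le_norm_add_nat[of "z + of_real (a + b)" k] assms by auto
  then have *: "real (Suc k) ^ 2 \<le> (?A * ?p) * (?B * ?q)"
    unfolding power2_eq_square by (intro mult_mono) auto
  have "?p > 0" "?q > 0"
    using assms by (auto simp: complex_eq_iff)
  then have "inverse (?p * ?q) \<le> ?A * ?B * inverse (real (Suc k) ^ 2)"
    using * by (simp add: field_simps)
  then have "\<bar>a * b\<bar> * inverse (?p * ?q) \<le> \<bar>a * b\<bar> * (?A * ?B * inverse (real (Suc k) ^ 2))"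
    by (intro mult_left_mono) auto
  then show ?thesis
    unfolding gamma_defect_def
    by (simp add: norm_divide norm_mult abs_mult divide_inverse norm_inverse mult_ac del: of_real_add)
qed

lemma pochhammer_Suc_prod_atMost:
  "pochhammer w (n + 1) = (\<Prod>k\<le>n. w + of_nat k :: 'a :: comm_semiring_1)"
  by (simp add: pochhammer_prod atLeast0LessThan lessThan_Suc_atMost)

text \<open>The factorials and the powers of n cancel, since the arguments in numerator and
  denominator have the same sum 2z + a + b.\<close>

lemma Gamma_series_cross_ratio:
  fixes z :: complex and a b :: real
  assumes "Im z \<noteq> 0"
  shows "Gamma_series (z + of_real (a + b)) n * Gamma_series z n
      / (Gamma_series (z + of_real a) n * Gamma_series (z + of_real b) n)
    = (\<Prod>k\<le>n. 1 + gamma_defect a b z k)"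
proof -
  have ne: "z + of_real r + of_nat k \<noteq> 0" for r k
    using assms by (auto simp: complex_eq_iff)
  have ne0: "z + of_nat k \<noteq> 0" for k
    using ne[of 0 k] by simp
  have exps: "exp ((z + of_real (a + b)) * l) * exp (z * l)
      = exp ((z + of_real a) * l) * exp ((z + of_real b) * l)" for l :: complex
    by (simp flip: exp_add add: algebra_simps)
  let ?P = "\<lambda>w. \<Prod>k\<le>n. w + of_nat k :: complex"
  have nz: "?P z \<noteq> 0" "?P (z + of_real r) \<noteq> 0" for r
    using ne ne0 by auto
  define l :: complex where "l = of_real (ln (real n))"
  have "Gamma_series (z + of_real (a + b)) n * Gamma_series z n
      / (Gamma_series (z + of_real a) n * Gamma_series (z + of_real b) n)
    = (fact n * fact n * (exp ((z + of_real (a + b)) * l) * exp (z * l)))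
       * (?P (z + of_real a) * ?P (z + of_real b))
      / (fact n * fact n * (exp ((z + of_real a) * l) * exp ((z + of_real b) * l)))
      / (?P (z + of_real (a + b)) * ?P z)"
    unfolding Gamma_series_def pochhammer_Suc_prod_atMost l_def[symmetric] by (simp del: of_real_add)
  also have "\<dots> = (?P (z + of_real a) * ?P (z + of_real b)) / (?P (z + of_real (a + b)) * ?P z)"
    unfolding exps by simp
  also have "\<dots> = (\<Prod>k\<le>n. ((z + of_real a + of_nat k) * (z + of_real b + of_nat k))
      / ((z + of_real (a + b) + of_nat k) * (z + of_nat k)))"
    by (simp only: prod.distrib prod_dividef)
  also have "\<dots> = (\<Prod>k\<le>n. 1 + gamma_defect a b z k)"
  proof (intro prod.cong refl)
    fix k
    have "(z + of_real a + of_nat k) * (z + of_real b + of_nat k)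
      = (z + of_real (a + b) + of_nat k) * (z + of_nat k) + of_real (a * b)"
      by (simp add: algebra_simps)
    then show "((z + of_real a + of_nat k) * (z + of_real b + of_nat k))
      / ((z + of_real (a + b) + of_nat k) * (z + of_nat k)) = 1 + gamma_defect a b z k"
            unfolding gamma_defect_def mult.commute[of "z + of_nat k"]
      using ne[of "a + b" k] ne0[of k] by (metis add_divide_distrib divide_self mult_eq_0_iff)
  qed
  finally show ?thesis .
qed

lemma Gamma_neq_zero_Im: "Im z \<noteq> 0 \<Longrightarrow> Gamma z \<noteq> (0 :: complex)"
  by (auto simp: Gamma_eq_zero_iff elim!: nonpos_Ints_cases)

text \<open>With d_k for the defects, the finite products satisfy |prod (1 + d_k) - 1| \<le> prod (1
  + |d_k|) - 1 \<le> exp (sum |d_k|) - 1, and this passes to the limit.\<close>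

lemma Gamma_cross_ratio_bound:
  fixes z :: complex and a b :: real
  assumes "Im z \<ge> 1"
  shows "norm (Gamma (z + of_real (a + b)) * Gamma z
      / (Gamma (z + of_real a) * Gamma (z + of_real b)) - 1)
    \<le> exp (\<Sum>k. norm (gamma_defect a b z k)) - 1"
proof -
  define M where
    "M = (\<lambda>k. \<bar>a * b\<bar> * (1 + \<bar>1 - Re z\<bar>) * (1 + \<bar>1 - (Re z + (a + b))\<bar>) * inverse (real (Suc k) ^ 2))"
  have "summable M"
    unfolding M_def using inverse_power_summable[of 2, where 'a = real]
    by (intro summable_mult) (simp add: summable_Suc_iff[of "\<lambda>k. inverse (real k ^ 2)"] del: of_nat_Suc)
  then have summable: "summable (\<lambda>k. norm (gamma_defect a b z k))"
    by (rule summable_comparison_test'[where N = 0])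
      (use gamma_defect_bound[OF assms] in \<open>auto simp: M_def\<close>)
  have "norm ((\<Prod>k\<le>n. 1 + gamma_defect a b z k) - 1) \<le> exp (\<Sum>k. norm (gamma_defect a b z k)) - 1"
    for n
  proof -
    have "norm ((\<Prod>k\<le>n. 1 + gamma_defect a b z k) - 1)
        \<le> (\<Prod>k\<le>n. 1 + norm (gamma_defect a b z k)) - 1"
      by (rule norm_prod_minus1_le_prod_minus1)
    also have "\<dots> \<le> exp (\<Sum>k\<le>n. norm (gamma_defect a b z k)) - 1"
      using prod_le_exp_sum[of "{..n}" "\<lambda>k. norm (gamma_defect a b z k)"] by simp
    also have "\<dots> \<le> exp (\<Sum>k. norm (gamma_defect a b z k)) - 1"
      using sum_le_suminf[OF summable, of "{..n}"] by simp
    finally show ?thesis .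
  qed
  moreover have "(\<lambda>n. \<Prod>k\<le>n. 1 + gamma_defect a b z k)
      \<longlonglongrightarrow> Gamma (z + of_real (a + b)) * Gamma z / (Gamma (z + of_real a) * Gamma (z + of_real b))"
    using assms
    by (subst Gamma_series_cross_ratio[symmetric])
      (auto intro!: tendsto_intros simp: Gamma_neq_zero_Im simp del: of_real_add)
  ultimately show ?thesis
    by (intro tendsto_upperbound[OF tendsto_norm[OF tendsto_diff[OF _ tendsto_const]]]) auto
qed

text \<open>Once Im z \<ge> 1, each defect is at most |ab| / Im z. By Tannery's theorem with the
  majorant \<open>M\<close>, which is constant on the line, the sum of the defects tends to
  0.\<close>

lemma Gamma_cross_ratio_tendsto:
  fixes z :: "'a \<Rightarrow> complex" and a b x :: real
  assumes Re: "\<And>t. Re (z t) = x" and Im: "filterlim (\<lambda>t. Im (z t)) at_top F"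
  shows "((\<lambda>t. Gamma (z t + of_real (a + b)) * Gamma (z t)
      / (Gamma (z t + of_real a) * Gamma (z t + of_real b))) \<longlongrightarrow> 1) F"
proof (cases "F = bot")
  case False
  define M where
    "M = (\<lambda>k. \<bar>a * b\<bar> * (1 + \<bar>1 - x\<bar>) * (1 + \<bar>1 - (x + (a + b))\<bar>) * inverse (real (Suc k) ^ 2))"
  have ev1: "eventually (\<lambda>t. Im (z t) \<ge> 1) F"
    using Im by (simp add: filterlim_at_top)
  have "((\<lambda>t. \<Sum>k. norm (gamma_defect a b (z t) k)) \<longlongrightarrow> (\<Sum>k::nat. 0)) F"
  proof (rule conjunct2[OF conjunct2[OF tannerys_theorem[where M = M]]])
    show "((\<lambda>t. norm (gamma_defect a b (z t) k)) \<longlongrightarrow> 0) F" for k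
    proof (rule Lim_null_comparison)
      show "eventually (\<lambda>t. norm (norm (gamma_defect a b (z t) k)) \<le> \<bar>a * b\<bar> / Im (z t)) F"
        using ev1
      proof eventually_elim
        case (elim t)
        have "Im (z t) \<le> norm (z t + of_nat k)" "Im (z t) \<le> norm (z t + of_real (a + b) + of_nat k)"
          using abs_Im_le_cmod[of "z t + of_nat k"]
            abs_Im_le_cmod[of "z t + of_real (a + b) + of_nat k"] by auto
        then have "Im (z t) * 1 \<le> norm (z t + of_nat k) * norm (z t + of_real (a + b) + of_nat k)"
          using elim by (intro mult_mono) auto
        then show ?case
          unfolding gamma_defect_def norm_divide norm_mult norm_of_real real_norm_def abs_divide abs_mult abs_norm_cancel abs_idempotent
          using elim by (intro divide_left_mono mult_pos_pos) (auto simp: complex_eq_iff abs_mult)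
      qed
      show "((\<lambda>t. \<bar>a * b\<bar> / Im (z t)) \<longlongrightarrow> 0) F"
        by (rule tendsto_divide_0[OF tendsto_const filterlim_at_top_imp_at_infinity[OF Im]])
    qed
    show "eventually (\<lambda>(k, t). norm (norm (gamma_defect a b (z t) k)) \<le> M k) (sequentially \<times>\<^sub>F F)"
    proof (rule eventually_mono[OF eventually_prodI[OF always_eventually ev1]])
      show "\<forall>k. True" by simp
    next
      fix p :: "nat \<times> 'a" assume "True \<and> 1 \<le> Im (z (snd p))" 
      then show "case p of (k, t) \<Rightarrow> norm (norm (gamma_defect a b (z t) k)) \<le> M k"
        using gamma_defect_bound[of "z (snd p)" a b "fst p"] by (cases p) (auto simp: M_def Re)
    qed
    show "summable M"
      unfolding M_def using inverse_power_summable[of 2, where 'a = real]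
      by (intro summable_mult) (simp add: summable_Suc_iff[of "\<lambda>k. inverse (real k ^ 2)"] del: of_nat_Suc)
  qed (use False in auto)
  then have "((\<lambda>t. exp (\<Sum>k. norm (gamma_defect a b (z t) k)) - 1) \<longlongrightarrow> exp 0 - 1) F"
    by (intro tendsto_intros) auto
  then have "((\<lambda>t. Gamma (z t + of_real (a + b)) * Gamma (z t)
      / (Gamma (z t + of_real a) * Gamma (z t + of_real b)) - 1) \<longlongrightarrow> 0) F"
    by (intro Lim_null_comparison[OF eventually_mono[OF ev1 Gamma_cross_ratio_bound]]) simp_all
  then show ?thesis
    by (simp add: Lim_null[symmetric])
qed auto

section \<open>Growth of Gamma quotients under a real shift\<close>

text \<open>
  By the Gauss product, \<open>\<bar>Gamma(x+iy)\<bar> / Gamma(x)\<close> is a limit of products of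
  \<open>(x+k) / \<bar>x+k+iy\<bar>\<close>, each of which increases with \<open>x\<close>.
\<close>
lemma norm_Gamma_quotient_mono:
  fixes z :: complex and d :: real
  assumes x: "Re z > 0" and d: "d \<ge> 0" and y: "Im z \<noteq> 0"
  shows "Gamma (Re z + d) / Gamma (Re z) \<le> norm (Gamma (z + of_real d) / Gamma z)"
proof -
  have nz: "w + of_nat k \<noteq> 0" if "Re w > 0" for w :: complex and k
    using that by (auto simp: complex_eq_iff)
  have ratio: "norm (Gamma_series w n) / Gamma_series (Re w) n
      = (\<Prod>k\<le>n. (Re w + real k) / norm (w + of_nat k))"
    if "n > 0" "Re w > 0" for w :: complex and n
  proof -
    have "pochhammer (Re w) (n + 1) > 0" "pochhammer w (n + 1) \<noteq> 0"
      using that nz[of w] unfolding pochhammer_Suc_prod_atMost by (auto intro!: prod_pos)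
    then show ?thesis
      using that unfolding Gamma_series_def
      by (simp add: norm_divide norm_mult norm_exp_eq_Re pochhammer_Suc_prod_atMost[simplified]
          prod_norm[symmetric] prod_dividef)
  qed
  have step: "(Re z + real k) / norm (z + of_nat k)
      \<le> (Re (z + of_real d) + real k) / norm (z + of_real d + of_nat k)" for k
  proof -
    define u where "u = Re z + real k"
    have u: "u > 0" using x by (simp add: u_def)
    have "u\<^sup>2 \<le> (u + d)\<^sup>2"
      using u d by (intro power_mono) auto
    then have "u\<^sup>2 * ((u + d)\<^sup>2 + (Im z)\<^sup>2) \<le> (u + d)\<^sup>2 * (u\<^sup>2 + (Im z)\<^sup>2)"
      using mult_right_mono[of "u\<^sup>2" "(u+d)\<^sup>2" "(Im z)\<^sup>2"] by (simp add: algebra_simps)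
    then have "sqrt (u\<^sup>2 * ((u + d)\<^sup>2 + (Im z)\<^sup>2)) \<le> sqrt ((u + d)\<^sup>2 * (u\<^sup>2 + (Im z)\<^sup>2))"
      by simp
    then have "u * sqrt ((u + d)\<^sup>2 + (Im z)\<^sup>2) \<le> (u + d) * sqrt (u\<^sup>2 + (Im z)\<^sup>2)"
      using u d by (simp add: real_sqrt_mult)
    moreover have "norm (z + of_nat k) = sqrt (u\<^sup>2 + (Im z)\<^sup>2)"
      "norm (z + of_real d + of_nat k) = sqrt ((u + d)\<^sup>2 + (Im z)\<^sup>2)"
      by (simp_all add: cmod_def u_def add_ac)
    moreover have "sqrt (u\<^sup>2 + (Im z)\<^sup>2) > 0" "sqrt ((u + d)\<^sup>2 + (Im z)\<^sup>2) > 0"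
      using y by (simp_all add: add_nonneg_pos)
    ultimately show ?thesis
      by (simp add: u_def field_simps)
  qed
  have pos: "Gamma (Re z) > 0" "Gamma (Re z + d) > 0"
    using x d by (auto intro!: Gamma_real_pos)
  have "norm (Gamma z) / Gamma (Re z) \<le> norm (Gamma (z + of_real d)) / Gamma (Re (z + of_real d))"
  proof (rule tendsto_le[OF sequentially_bot])
    show "(\<lambda>n. norm (Gamma_series z n) / Gamma_series (Re z) n) \<longlonglongrightarrow> norm (Gamma z) / Gamma (Re z)"
      using pos by (intro tendsto_intros) auto
    show "(\<lambda>n. norm (Gamma_series (z + of_real d) n) / Gamma_series (Re (z + of_real d)) n)
        \<longlonglongrightarrow> norm (Gamma (z + of_real d)) / Gamma (Re (z + of_real d))"
      using pos by (intro tendsto_intros) auto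
    show "\<forall>\<^sub>F n in sequentially. norm (Gamma_series z n) / Gamma_series (Re z) n
        \<le> norm (Gamma_series (z + of_real d) n) / Gamma_series (Re (z + of_real d)) n"
      using eventually_gt_at_top[of "0::nat"]
    proof eventually_elim
      case (elim n)
      show ?case
        using x d elim unfolding ratio[OF elim x]
        by (subst ratio) (auto intro!: prod_mono divide_nonneg_nonneg step[simplified])
    qed
  qed
  moreover have "norm (Gamma z) > 0"
    using Gamma_neq_zero_Im[OF y] by simp
  ultimately show ?thesis
    using pos by (simp add: norm_divide field_simps)
qed

text \<open>One unit of the shift gives, by Gamma(w+1) = w Gamma(w), a factor of norm at least Im z.
  The remaining shift d - 1 only needs a positive lower bound, which monotonicity in the real part
  gives after a translation by m into the right half-plane.\<close>

lemma Gamma_shift_at_infinity: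
  fixes z :: "'a \<Rightarrow> complex" and d x :: real
  assumes Re: "\<And>t. Re (z t) = x" and Im: "filterlim (\<lambda>t. Im (z t)) at_top F" and d: "d \<ge> 1"
  shows "filterlim (\<lambda>t. norm (Gamma (z t + of_real d) / Gamma (z t))) at_top F"
proof -
  obtain m :: nat where m: "x + real m > 0"
    by (metis add.commute less_add_same_cancel1 neg_less_iff_less diff_gt_0_iff_gt diff_minus_eq_add reals_Archimedean2)
  define c where "c = Gamma (x + real m + (d - 1)) / Gamma (x + real m)"
  have c: "c > 0"
    unfolding c_def using m d by (intro divide_pos_pos Gamma_real_pos) auto
  \<comment> \<open>This cross ratio tends to 1; it carries the lower bound for the shift by d - 1
    from z + m back to z, at the cost of a factor 2.\<close>
  define q where "q = (\<lambda>t. Gamma (z t + of_real ((d - 1) + real m)) * Gamma (z t)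
      / (Gamma (z t + of_real (d - 1)) * Gamma (z t + of_real (real m))))"
  have "((\<lambda>t. norm (q t)) \<longlongrightarrow> norm (1 :: complex)) F"
    unfolding q_def by (intro tendsto_norm Gamma_cross_ratio_tendsto[OF Re Im])
  then have "eventually (\<lambda>t. norm (q t) < 2) F"
    by (rule order_tendstoD) simp
  moreover have "eventually (\<lambda>t. Im (z t) \<ge> 1) F"
    using Im by (simp add: filterlim_at_top)
  ultimately have "eventually (\<lambda>t. Im (z t) * (c / 2) \<le> norm (Gamma (z t + of_real d) / Gamma (z t))) F"
  proof eventually_elim
    case (elim t)
    define w where "w = z t + of_real (d - 1)"
    have ne: "Gamma (z t + of_real r) \<noteq> 0" "Gamma (z t) \<noteq> 0" for r
      using elim by (auto intro!: Gamma_neq_zero_Im)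
    have "w \<notin> \<int>\<^sub>\<le>\<^sub>0"
      using elim by (auto simp: w_def elim!: nonpos_Ints_cases dest!: arg_cong[of _ _ Im])
    then have "Gamma (w + 1) = w * Gamma w"
      by (rule Gamma_plus1)
    then have G1: "Gamma (z t + of_real d) = w * Gamma w"
      by (simp add: w_def)
    have "c \<le> norm (Gamma (z t + of_real (real m) + of_real (d - 1)) / Gamma (z t + of_real (real m)))"
      using norm_Gamma_quotient_mono[of "z t + of_real (real m)" "d - 1"] m d elim Re
      by (simp add: c_def)
    also have "Gamma (z t + of_real (real m) + of_real (d - 1)) / Gamma (z t + of_real (real m))
        = q t * (Gamma w / Gamma (z t))"
      using ne(1)[of "real m"] ne(1)[of "d - 1"] ne(2)
      unfolding q_def w_def by (simp add: field_simps)
    also have "norm \<dots> \<le> 2 * norm (Gamma w / Gamma (z t))"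
      unfolding norm_mult using elim by (intro mult_right_mono) auto
    finally have *: "c / 2 \<le> norm (Gamma w / Gamma (z t))"
      by simp
    have "Im (z t) \<le> norm w"
      using abs_Im_le_cmod[of w] by (simp add: w_def)
    then have "Im (z t) * (c / 2) \<le> norm w * norm (Gamma w / Gamma (z t))"
      using * c elim by (intro mult_mono) auto
    then show ?case
      by (simp add: G1 norm_mult norm_divide)
  qed
  moreover have "filterlim (\<lambda>t. Im (z t) * (c / 2)) at_top F"
    by (rule filterlim_at_top_mult_tendsto_pos[OF tendsto_const _ Im]) (use c in auto)
  ultimately show ?thesis
    by (rule filterlim_at_top_mono[rotated])
qed

section \<open>Dirichlet series on vertical lines\<close>

text \<open>By Dirichlet's simultaneous approximation, \<tau> ln n / (2 pi) can be brought close to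
  integers for the first j + 1 values of n at once; then n^(-i \<tau>) is close to 1.\<close>

lemma simultaneous_almost_period:
  obtains \<tau> :: "nat \<Rightarrow> real"
  where "filterlim \<tau> at_top sequentially"
    and "\<And>n. n > 0 \<Longrightarrow> (\<lambda>j. of_nat n powr (- (\<i> * of_real (\<tau> j))) :: complex) \<longlonglongrightarrow> 1"
proof -
  have "\<exists>\<tau> p. \<tau> \<ge> real (Suc j) \<and>
      (\<forall>i<Suc j. \<bar>\<tau> * (ln (real (Suc i)) / (2 * pi)) - of_int (p i)\<bar> < 1 / real (Suc j))" for j
  proof -
    \<comment> \<open>The approximation theorem only gives q > 0. The extra factor
      \<open>Suc j\<close> makes the almost period q (j + 1) at least j + 1, so that the sequence
      tends to infinity.\<close>
    define \<theta> where "\<theta> = (\<lambda>i. real (Suc j) * (ln (real (Suc i)) / (2 * pi)))"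
    obtain q p where q: "0 < q"
      "\<And>i. i < Suc j \<Longrightarrow> \<bar>of_int q * \<theta> i - of_int (p i)\<bar> < 1 / real (Suc j)"
      using Dirichlet_approx_simult[of "Suc j" "Suc j" \<theta>] by (metis zero_less_Suc)
    then have "1 * real (Suc j) \<le> of_int q * real (Suc j)"
      by (intro mult_right_mono) auto
    then show ?thesis
      using q by (intro exI[of _ "of_int q * real (Suc j)"] exI[of _ p]) (auto simp: \<theta>_def mult.assoc)
  qed
  then obtain \<tau> p where \<tau>: "\<And>j. \<tau> j \<ge> real (Suc j)"
    and p: "\<And>j i. i < Suc j \<Longrightarrow>
      \<bar>\<tau> j * (ln (real (Suc i)) / (2 * pi)) - of_int (p j i)\<bar> < 1 / real (Suc j)"
    by metis
  show ?thesis
  proof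
    show "filterlim \<tau> at_top sequentially"
      by (rule filterlim_at_top_mono[OF filterlim_compose[OF filterlim_real_sequentially filterlim_Suc]])
        (use \<tau> in auto)
  next
    fix n :: nat assume "n > 0"
    then obtain i where i: "n = Suc i" by (cases n) auto
    define \<delta> where "\<delta> = (\<lambda>j. \<tau> j * (ln (real n) / (2 * pi)) - of_int (p j i))"
    have "\<delta> \<longlonglongrightarrow> 0"
    proof (rule Lim_null_comparison)
      show "eventually (\<lambda>j. norm (\<delta> j) \<le> 1 / real (Suc j)) sequentially"
        using eventually_ge_at_top[of i]
        by eventually_elim (use p[of i] in \<open>auto simp: \<delta>_def i intro: less_imp_le\<close>)
      show "(\<lambda>j. 1 / real (Suc j)) \<longlonglongrightarrow> 0"
        using LIMSEQ_inverse_real_of_nat by (simp add: inverse_eq_divide)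
    qed
    then have "(\<lambda>j. cis (- (2 * pi * \<delta> j))) \<longlonglongrightarrow> cis (- (2 * pi * 0))"
      by (intro tendsto_intros)
    moreover have "of_nat n powr (- (\<i> * of_real (\<tau> j))) = cis (- (2 * pi * \<delta> j))" for j
    proof -
      have "of_nat n powr (- (\<i> * of_real (\<tau> j))) = cis (- (\<tau> j * ln (real n)))"
        using \<open>n > 0\<close> by (simp add: powr_def cis_conv_exp Ln_of_nat mult_ac)
      also have "- (\<tau> j * ln (real n)) = - (2 * pi * \<delta> j) + 2 * pi * of_int (- p j i)"
        by (simp add: \<delta>_def field_simps)
      also have "cis \<dots> = cis (- (2 * pi * \<delta> j))"
        unfolding cis_mult[symmetric] by (subst cis_multiple_2pi) auto
      finally show ?thesis .
    qed
    ultimately show "(\<lambda>j. of_nat n powr (- (\<i> * of_real (\<tau> j))) :: complex) \<longlonglongrightarrow> 1"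
      by simp
  qed
qed

lemma norm_dirichlet_term:
  "norm (dirichlet_term a s (Suc n)) = norm (a (Suc n)) * real (Suc n) powr (- Re s)"
  by (simp add: dirichlet_term_def norm_mult powr_def Ln_of_nat norm_exp_eq_Re del: of_nat_Suc)

lemma extended_selberg_series:
  assumes "extended_selberg a L" "Re s > 1"
  shows "summable (\<lambda>n. norm (dirichlet_term a s (Suc n)))"
    and "L s = (\<Sum>n. dirichlet_term a s (Suc n))"
  using assms unfolding extended_selberg_def by blast+

text \<open>The norm of each term depends only on the real part of the argument, so the series at w
  dominates all its vertical translates and the limit may be taken termwise.\<close>

lemma extended_selberg_almost_period:
  assumes L: "extended_selberg a L" and w: "Re w > 1"
    and \<tau>: "\<And>n. n > 0 \<Longrightarrow> (\<lambda>j. of_nat n powr (- (\<i> * of_real (\<tau> j))) :: complex) \<longlonglongrightarrow> 1"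
  shows "(\<lambda>j. L (w + \<i> * of_real (\<tau> j))) \<longlonglongrightarrow> L w"
proof -
  have "(\<lambda>j. \<Sum>k. dirichlet_term a (w + \<i> * of_real (\<tau> j)) (Suc k))
      \<longlonglongrightarrow> (\<Sum>k. dirichlet_term a w (Suc k))"
  proof (rule conjunct2[OF conjunct2[OF tannerys_theorem[where M = "\<lambda>k. norm (dirichlet_term a w (Suc k))"]]])
    show "(\<lambda>j. dirichlet_term a (w + \<i> * of_real (\<tau> j)) (Suc k)) \<longlonglongrightarrow> dirichlet_term a w (Suc k)" for k
    proof -
      have "dirichlet_term a (w + \<i> * of_real (\<tau> j)) (Suc k)
          = dirichlet_term a w (Suc k) * of_nat (Suc k) powr (- (\<i> * of_real (\<tau> j)))" for j
        unfolding dirichlet_term_def minus_add_distrib powr_add by (simp only: mult.assoc)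
      moreover have "(\<lambda>j. dirichlet_term a w (Suc k) * of_nat (Suc k) powr (- (\<i> * of_real (\<tau> j))))
          \<longlonglongrightarrow> dirichlet_term a w (Suc k) * 1"
        by (intro tendsto_intros \<tau>) simp
      ultimately show ?thesis by simp
    qed
    show "summable (\<lambda>k. norm (dirichlet_term a w (Suc k)))"
      by (rule extended_selberg_series(1)[OF L w])
    show "eventually (\<lambda>(k, j). norm (dirichlet_term a (w + \<i> * of_real (\<tau> j)) (Suc k))
        \<le> norm (dirichlet_term a w (Suc k))) (sequentially \<times>\<^sub>F sequentially)"
      unfolding norm_dirichlet_term by (rule always_eventually) simp
  qed (rule sequentially_bot)
  moreover have "Re (w + \<i> * of_real (\<tau> j)) > 1" for j
    using w by simp
  ultimately show ?thesis
    by (simp only: extended_selberg_series(2)[OF L w] extended_selberg_series(2)[OF L])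
qed

section \<open>The limit for Re s \<rightarrow> \<infinity>, uniformly in Im s\<close>

lemma filtercomap_Re_at_top_neq_bot: "filtercomap Re at_top \<noteq> bot"
  by (rule filtercomap_neq_bot_surj) (simp_all add: surjI[of Re of_real])

text \<open>All terms with n \<ge> 2 vanish in the limit, and for Re s \<ge> 2 the series at 2
  dominates.\<close>

lemma extended_selberg_tendsto_first_coeff:
  assumes L: "extended_selberg a L"
  shows "(L \<longlongrightarrow> a 1) (filtercomap Re at_top)"
proof -
  let ?F = "filtercomap Re at_top"
  have nontriv: "?F \<noteq> bot"
    by (rule filtercomap_Re_at_top_neq_bot)
  have ev2: "eventually (\<lambda>s. Re s \<ge> 2) ?F"
    by (auto simp: eventually_filtercomap_at_top_linorder)
  have "((\<lambda>s. \<Sum>k. dirichlet_term a s (Suc k)) \<longlongrightarrow> (\<Sum>k. if k = 0 then a 1 else 0)) ?F"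
  proof (rule conjunct2[OF conjunct2[OF tannerys_theorem[where M = "\<lambda>k. norm (dirichlet_term a 2 (Suc k))"]]])
    show "((\<lambda>s. dirichlet_term a s (Suc k)) \<longlongrightarrow> (if k = 0 then a 1 else 0)) ?F" for k
    proof (cases "k = 0")
      case True
      then show ?thesis by (simp add: dirichlet_term_def)
    next
      case False
      have "((\<lambda>x. norm (a (Suc k)) * real (Suc k) powr (- x)) \<longlongrightarrow> 0) at_top"
        using False by real_asymp
      then have "((\<lambda>s. norm (dirichlet_term a s (Suc k))) \<longlongrightarrow> 0) ?F"
        unfolding norm_dirichlet_term by (rule filterlim_compose) (rule filterlim_filtercomap)
      then show ?thesis
        using False by (simp add: tendsto_norm_zero_iff)
    qed
    show "summable (\<lambda>k. norm (dirichlet_term a 2 (Suc k)))"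
      by (rule extended_selberg_series(1)[OF L]) simp
    show "eventually (\<lambda>(k, s). norm (dirichlet_term a s (Suc k)) \<le> norm (dirichlet_term a 2 (Suc k)))
        (sequentially \<times>\<^sub>F ?F)"
    proof (rule eventually_mono[OF eventually_prodI[OF always_eventually ev2]])
      show "\<forall>k. True" by simp
    next
      fix p :: "nat \<times> complex" assume "True \<and> 2 \<le> Re (snd p)"
      then show "case p of (k, s) \<Rightarrow>
          norm (dirichlet_term a s (Suc k)) \<le> norm (dirichlet_term a 2 (Suc k))"
        unfolding norm_dirichlet_term by (cases p) (auto intro!: mult_left_mono powr_mono)
    qed
  qed (rule nontriv)
  moreover have "(\<Sum>k. if k = 0 then a 1 else 0) = a 1"
    using suminf_finite[of "{0::nat}" "\<lambda>k. if k = 0 then a 1 else 0"] by simp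
  ultimately have "((\<lambda>s. \<Sum>k. dirichlet_term a s (Suc k)) \<longlongrightarrow> a 1) ?F"
    by simp
  moreover have "eventually (\<lambda>s. (\<Sum>k. dirichlet_term a s (Suc k)) = L s) ?F"
    using ev2 by eventually_elim (use extended_selberg_series(2)[OF L] in auto)
  ultimately show ?thesis
    by (rule Lim_transform_eventually)
qed

lemma extended_selberg_holomorphic:
  assumes "extended_selberg a L"
  shows "L holomorphic_on - {1}"
proof -
  obtain k F where F: "F holomorphic_on UNIV" "\<And>s. s \<noteq> 1 \<Longrightarrow> F s = (s - 1) ^ k * L s"
    using assms unfolding extended_selberg_def by blast
  have "(\<lambda>s. F s / (s - 1) ^ k) holomorphic_on - {1}"
    by (intro holomorphic_intros holomorphic_on_subset[OF F(1)]) auto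
  then show ?thesis
    by (rule holomorphic_transform) (use F(2) in auto)
qed

section \<open>The functional equation on vertical lines\<close>

definition gamma_factor :: "nat \<Rightarrow> real \<Rightarrow> (nat \<Rightarrow> real) \<Rightarrow> (nat \<Rightarrow> complex) \<Rightarrow> complex \<Rightarrow> complex" where
  "gamma_factor K Q lam nu s = of_real Q powr s * (\<Prod>j=1..K. Gamma (of_real (lam j) * s + nu j))"

text \<open>The exponential of the second difference of log f with step 1. It is multiplicative in f
  and equals 1 for nonzero constants and exponentials, so it removes both \<omega> and
  \<open>Q powr s\<close>.\<close>

definition second_ratio :: "(complex \<Rightarrow> complex) \<Rightarrow> complex \<Rightarrow> complex" where
  "second_ratio f w = f (w + 2) * f w / (f (w + 1))\<^sup>2"

lemma second_ratio_mult: "second_ratio (\<lambda>w. f w * g w) w = second_ratio f w * second_ratio g w"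
  by (simp add: second_ratio_def power_mult_distrib)

lemma second_ratio_divide: "second_ratio (\<lambda>w. f w / g w) w = second_ratio f w / second_ratio g w"
  by (simp add: second_ratio_def power_divide)

lemma second_ratio_power: "second_ratio (\<lambda>w. f w ^ n) w = second_ratio f w ^ n"
  by (simp add: second_ratio_def power_divide power_mult_distrib power_commutes flip: power_mult
      add: mult.commute)

lemma second_ratio_prod: "second_ratio (\<lambda>w. \<Prod>j\<in>A. f j w) w = (\<Prod>j\<in>A. second_ratio (f j) w)"
  by (simp add: second_ratio_def prod.distrib prod_dividef prod_power_distrib)

text \<open>A unit shift of w moves the j-th Gamma argument by \<open>lam j\<close>, so each factor
  contributes a cross ratio with a = b = \<open>lam j\<close>.\<close>

lemma second_ratio_gamma_factor:
  fixes w :: "'a \<Rightarrow> complex"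
  assumes Q: "Q > 0" and lam: "\<And>j. j \<in> {1..K} \<Longrightarrow> lam j > 0"
    and Re: "\<And>t. Re (w t) = x" and Im: "filterlim (\<lambda>t. Im (w t)) at_top F"
  shows "((\<lambda>t. second_ratio (gamma_factor K Q lam nu) (w t)) \<longlongrightarrow> 1) F"
proof -
  have powr: "second_ratio (\<lambda>w. of_real Q powr w) v = 1" for v
    using Q by (simp add: second_ratio_def powr_add power2_eq_square powr_of_real)
  have "((\<lambda>t. second_ratio (\<lambda>w. Gamma (of_real (lam j) * w + nu j)) (w t)) \<longlongrightarrow> 1) F"
    if j: "j \<in> {1..K}" for j
  proof -
    have "filterlim (\<lambda>t. Im (nu j) + lam j * Im (w t)) at_top F"
      by (intro filterlim_tendsto_add_at_top[OF tendsto_const]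
          filterlim_tendsto_pos_mult_at_top[OF tendsto_const lam[OF j] Im])
    then have "filterlim (\<lambda>t. Im (of_real (lam j) * w t + nu j)) at_top F"
      by (simp add: add.commute)
    from Gamma_cross_ratio_tendsto[OF _ this, of "lam j * x + Re (nu j)" "lam j" "lam j"]
    show ?thesis
      by (simp add: Re second_ratio_def power2_eq_square algebra_simps)
  qed
  then have "((\<lambda>t. \<Prod>j=1..K. second_ratio (\<lambda>w. Gamma (of_real (lam j) * w + nu j)) (w t))
      \<longlongrightarrow> (\<Prod>j=1..K. 1)) F"
    by (intro tendsto_prod)
  then show ?thesis
    unfolding gamma_factor_def second_ratio_mult second_ratio_prod powr by simp
qed

lemma filterlim_prod_at_top:
  fixes f :: "'a \<Rightarrow> 'b \<Rightarrow> real"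
  assumes "finite A" "A \<noteq> {}" "\<And>j. j \<in> A \<Longrightarrow> filterlim (f j) at_top F"
  shows "filterlim (\<lambda>t. \<Prod>j\<in>A. f j t) at_top F"
  using assms by (induction A rule: finite_ne_induct) (auto intro!: filterlim_at_top_mult_at_top)

text \<open>The shift d moves every Gamma argument by at least 1, so each Gamma quotient diverges; K
  > 0 guarantees that there is one.\<close>

lemma gamma_factor_at_top:
  fixes w :: "'a \<Rightarrow> complex"
  assumes Q: "Q > 0" and K: "K > 0" and lam: "\<And>j. j \<in> {1..K} \<Longrightarrow> lam j * d \<ge> 1"
    and d: "d > 0"
    and Re: "\<And>t. Re (w t) = x" and Im: "filterlim (\<lambda>t. Im (w t)) at_top F"
  shows "filterlim (\<lambda>t. norm (gamma_factor K Q lam nu (w t + of_real d) / gamma_factor K Q lam nu (w t)))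
    at_top F"
proof -
  let ?z = "\<lambda>j t. of_real (lam j) * w t + nu j"
  have "filterlim (\<lambda>t. norm (Gamma (?z j t + of_real (lam j * d)) / Gamma (?z j t))) at_top F"
    if j: "j \<in> {1..K}" for j
  proof (rule Gamma_shift_at_infinity)
    have pos: "lam j > 0"
      using lam[OF j] d by (smt (verit) mult_nonpos_nonneg)
    have "filterlim (\<lambda>t. Im (nu j) + lam j * Im (w t)) at_top F"
      by (intro filterlim_tendsto_add_at_top[OF tendsto_const]
          filterlim_tendsto_pos_mult_at_top[OF tendsto_const pos Im])
    then show "filterlim (\<lambda>t. Im (?z j t)) at_top F"
      by (simp add: add.commute)
    show "Re (?z j t) = lam j * x + Re (nu j)" for t
      by (simp add: Re)
  qed (use lam j in auto)
  then have "filterlim (\<lambda>t. \<Prod>j=1..K. norm (Gamma (?z j t + of_real (lam j * d)) / Gamma (?z j t)))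
      at_top F"
    using K by (intro filterlim_prod_at_top) auto
  moreover have "Q powr d > 0"
    using Q by simp
  ultimately have "filterlim (\<lambda>t. Q powr d *
      (\<Prod>j=1..K. norm (Gamma (?z j t + of_real (lam j * d)) / Gamma (?z j t)))) at_top F"
    by (intro filterlim_tendsto_pos_mult_at_top[OF tendsto_const])
  moreover have "norm (gamma_factor K Q lam nu (w t + of_real d) / gamma_factor K Q lam nu (w t))
      = Q powr d * (\<Prod>j=1..K. norm (Gamma (?z j t + of_real (lam j * d)) / Gamma (?z j t)))" for t
  proof -
    have "of_real Q powr (w t + of_real d) = of_real Q powr w t * (of_real (Q powr d) :: complex)"
      using Q by (simp add: powr_add powr_of_real)
    moreover have "of_real Q powr w t \<noteq> 0"
      using Q by simp
    moreover have shift: "of_real (lam j) * (w t + of_real d) + nu j = ?z j t + of_real (lam j * d)" for j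
      by (simp add: algebra_simps)
    ultimately show ?thesis
      unfolding gamma_factor_def shift using Q
      by (simp add: norm_mult norm_divide prod_norm prod_dividef del: of_real_mult)
  qed
  ultimately show ?thesis by simp
qed

section \<open>The pointwise functional equation and reflection\<close>

lemma completed_L_eq: "completed_L L K Q lam nu s = L s * gamma_factor K Q lam nu s"
  by (simp add: completed_L_def gamma_factor_def)

lemma isCont_eventually_eq:
  fixes f g :: "complex \<Rightarrow> 'b :: t2_space"
  assumes "isCont f z" "isCont g z" "\<forall>\<^sub>F w in at z. f w = g w"
  shows "f z = g z"
  using LIM_unique[of g "f z" z "g z"] Lim_transform_eventually[of f "f z" "at z" g] assms
  by (simp add: isCont_def)

text \<open>The defining identity admits a sparse exceptional set. Where s and all Gamma arguments
  lie above the real axis, both sides are continuous, which removes the exceptions.\<close>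

lemma functional_equation_pointwise:
  assumes fe: "functional_equation L K Q lam nu \<omega>" and hol: "L holomorphic_on - {1}"
    and s: "Im s > 0" "\<And>j. j \<in> {1..K} \<Longrightarrow> Im (of_real (lam j) * s + nu j) > 0"
  shows "completed_L L K Q lam nu s = \<omega> * cnj (completed_L L K Q lam nu (1 - cnj s))"
proof -
  let ?C = "completed_L L K Q lam nu"
  have cont: "isCont ?C v"
    if "Im v > 0" and pos: "\<And>j. j \<in> {1..K} \<Longrightarrow> Im (of_real (lam j) * v + nu j) > 0" for v
  proof -
    have "isCont L v"
      using holomorphic_on_imp_continuous_on[OF hol] that(1)
      by (auto simp: continuous_on_eq_continuous_at open_Compl)
    moreover have "of_real (lam j) * v + nu j \<notin> \<int>\<^sub>\<le>\<^sub>0" if "j \<in> {1..K}" for j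
    proof
      assume "of_real (lam j) * v + nu j \<in> \<int>\<^sub>\<le>\<^sub>0"
      then have "Im (of_real (lam j) * v + nu j) = 0"
        by (metis complex_Im_of_int nonpos_Ints_cases)
      then show False
        using pos[OF that] by simp
    qed
    moreover have "Q > 0"
      using fe by (simp add: functional_equation_def)
    ultimately show ?thesis
      unfolding completed_L_def by (intro continuous_intros) auto
  qed
  have "isCont ?C s"
    by (rule cont[OF s])
  moreover have "isCont (\<lambda>s. \<omega> * cnj (?C (1 - cnj s))) s"
  proof (intro isCont_mult isCont_cnj continuous_const)
    have "isCont (\<lambda>s. 1 - cnj s) s"
      by (intro continuous_intros)
    \<comment> \<open>The reflection preserves the imaginary part of s and, as \<open>lam j\<close>
      is real, those of the Gamma arguments.\<close>
    moreover have "isCont ?C (1 - cnj s)"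
      using s by (intro cont) auto
    ultimately show "isCont (\<lambda>s. ?C (1 - cnj s)) s"
      by (rule isCont_o2)
  qed
  moreover have "eventually (\<lambda>s. ?C s = \<omega> * cnj (?C (1 - cnj s))) (at s)"
    using fe unfolding functional_equation_def
    by (blast intro: eventually_cosparse_imp_eventually_at)
  ultimately show ?thesis
    by (rule isCont_eventually_eq)
qed

lemma positive_degree_functional_equation:
  assumes L: "extended_selberg a L" and deg: "L_degree L > 0"
  shows "\<exists>K Q lam nu \<omega>. functional_equation L K Q lam nu \<omega> \<and> K > 0"
proof (rule ccontr)
  assume "\<not> ?thesis"
  then have K: "K = 0" if "functional_equation L K Q lam nu \<omega>" for K Q lam nu \<omega>
    using that by (metis gr0I)
  obtain K Q lam nu \<omega> where "functional_equation L K Q lam nu \<omega>"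
    using L unfolding extended_selberg_def by blast
  \<comment> \<open>Every functional equation now has the empty sum as its degree, so the description is
    well-defined without the invariance of the degree.\<close>
  then have "L_degree L = 0"
    unfolding L_degree_def by (intro the_equality) (use K in fastforce)+
  then show False
    using deg by simp
qed

abbreviation vline :: "complex \<Rightarrow> real \<Rightarrow> complex" where
  "vline w t \<equiv> w + \<i> * of_real t"

text \<open>\<open>Y\<close> is the quotient of Gamma factors at a point and at its reflection. Both
  lie at the same height, so its second ratio and its growth follow from the results on vertical
  lines.\<close>

lemma reflection_factor_exists:
  assumes L: "extended_selberg a L" and deg: "L_degree L > 0"
  obtains Y \<sigma>0 where
    "\<And>w. \<forall>\<^sub>F t in at_top. cnj (L (1 - cnj (vline w t))) = Y (vline w t) * L (vline w t)"
    "\<And>w. ((\<lambda>t. second_ratio Y (vline w t)) \<longlongrightarrow> 1) at_top"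
    "\<And>w. Re w \<ge> \<sigma>0 \<Longrightarrow> filterlim (\<lambda>t. norm (Y (vline w t))) at_top at_top"
proof -
  obtain K Q lam nu \<omega> where fe: "functional_equation L K Q lam nu \<omega>" and K: "K > 0"
    using positive_degree_functional_equation[OF L deg] by blast
  have Q: "Q > 0" and lam: "\<And>j. j \<in> {1..K} \<Longrightarrow> lam j > 0" and \<omega>: "norm \<omega> = 1"
    using fe unfolding functional_equation_def by auto
  define \<gamma> where "\<gamma> = gamma_factor K Q lam nu"
  define Y where "Y = (\<lambda>w. \<gamma> w / (\<omega> * cnj (\<gamma> (1 - cnj w))))"
  have \<omega>0: "\<omega> \<noteq> 0" using \<omega> by auto
  have Imlim: "filterlim (\<lambda>t. Im (vline w t)) at_top at_top" for w
    by (simp add: filterlim_tendsto_add_at_top[OF tendsto_const filterlim_ident])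
  show ?thesis
  proof
    fix w
    have "\<forall>\<^sub>F t in at_top. \<forall>j\<in>{1..K}. Im (of_real (lam j) * vline w t + nu j) > 0"
    proof (intro eventually_ball_finite ballI)
      fix j assume j: "j \<in> {1..K}"
      have "filterlim (\<lambda>t. lam j * Im w + Im (nu j) + lam j * t) at_top at_top"
        by (intro filterlim_tendsto_add_at_top[OF tendsto_const]
            filterlim_tendsto_pos_mult_at_top[OF tendsto_const lam[OF j] filterlim_ident])
      then have "\<forall>\<^sub>F t in at_top. lam j * Im w + Im (nu j) + lam j * t > 0"
        by (simp add: filterlim_at_top_dense)
      then show "\<forall>\<^sub>F t in at_top. Im (of_real (lam j) * vline w t + nu j) > 0"
        by (simp add: algebra_simps)
    qed auto
    moreover have "\<forall>\<^sub>F t in at_top. Im (vline w t) > 0"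
      using Imlim[of w] unfolding filterlim_at_top_dense by blast
    ultimately show "\<forall>\<^sub>F t in at_top. cnj (L (1 - cnj (vline w t))) = Y (vline w t) * L (vline w t)"
    proof eventually_elim
      case (elim t)
      define s where "s = vline w t"
      have "\<gamma> (1 - cnj s) \<noteq> 0"
        unfolding \<gamma>_def gamma_factor_def
        using elim(1) Q Gamma_neq_zero_Im unfolding s_def[symmetric]
        by (force simp: prod_zero_iff)
      moreover have "L s * \<gamma> s = \<omega> * (cnj (L (1 - cnj s)) * cnj (\<gamma> (1 - cnj s)))"
        using functional_equation_pointwise[OF fe extended_selberg_holomorphic[OF L], of s] elim
        unfolding completed_L_eq \<gamma>_def s_def by simp
      ultimately show ?case
        using \<omega>0 unfolding s_def[symmetric] Y_def by (simp add: field_simps)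
    qed
  next
    fix w
    have 1: "((\<lambda>t. second_ratio \<gamma> (vline w t)) \<longlongrightarrow> 1) at_top"
      unfolding \<gamma>_def by (rule second_ratio_gamma_factor[OF Q lam _ Imlim, where x = "Re w"]) auto
    \<comment> \<open>The reflections of w, w + 1, w + 2 are v + 2, v + 1, v. The order is reversed,
      under which the second ratio is symmetric.\<close>
    define v where "v = - 1 - cnj w"
    have 2: "((\<lambda>t. cnj (second_ratio \<gamma> (vline v t))) \<longlongrightarrow> cnj 1) at_top"
      unfolding \<gamma>_def by (intro tendsto_cnj second_ratio_gamma_factor[OF Q lam _ Imlim, where x = "Re v"]) auto
    have "second_ratio (\<lambda>w. cnj (\<gamma> (1 - cnj w))) (vline w t) = cnj (second_ratio \<gamma> (vline v t))" for t
    proof -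
      have *: "1 - cnj (vline w t + 2) = vline v t" "1 - cnj (vline w t) = vline v t + 2"
        "1 - cnj (vline w t + 1) = vline v t + 1"
        by (simp_all add: v_def)
      show ?thesis
        unfolding second_ratio_def * by (simp add: mult.commute)
    qed
    moreover have "second_ratio (\<lambda>w. \<omega>) u = 1" for u
      using \<omega>0 by (simp add: second_ratio_def power2_eq_square)
    ultimately have "second_ratio Y (vline w t)
        = second_ratio \<gamma> (vline w t) / cnj (second_ratio \<gamma> (vline v t))" for t
      unfolding Y_def second_ratio_divide second_ratio_mult by simp
    then show "((\<lambda>t. second_ratio Y (vline w t)) \<longlongrightarrow> 1) at_top"
      using tendsto_divide[OF 1 2] by simp
  next
    \<comment> \<open>Any d \<ge> B satisfies \<open>lam j * d \<ge> 1\<close> for all j, as the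
      growth of the Gamma factors demands.\<close>
    define B where "B = Max ((\<lambda>j. inverse (lam j)) ` {1..K})"
    fix w assume w: "Re w \<ge> 1 + \<bar>B\<bar>"
    \<comment> \<open>The horizontal distance from the reflected point 1 - \<open>cnj w\<close> to
      w.\<close>
    define d where "d = 2 * Re w - 1"
    have d: "d > 0" "d \<ge> B"
      using w by (auto simp: d_def)
    have lamd: "lam j * d \<ge> 1" if j: "j \<in> {1..K}" for j
    proof -
      have "inverse (lam j) \<le> B"
        unfolding B_def using j by (intro Max_ge) auto
      then have "lam j * inverse (lam j) \<le> lam j * d"
        using d lam[OF j] by (intro mult_left_mono) auto
      then show ?thesis
        using lam[OF j] by simp
    qed
    define v where "v = 1 - cnj w"
    have "filterlim (\<lambda>t. norm (\<gamma> (vline v t + of_real d) / \<gamma> (vline v t))) at_top at_top"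
      unfolding \<gamma>_def by (rule gamma_factor_at_top[OF Q K lamd d(1) _ Imlim, where x = "Re v"]) auto
    moreover have "norm (Y (vline w t)) = norm (\<gamma> (vline v t + of_real d) / \<gamma> (vline v t))" for t
    proof -
      have *: "1 - cnj (vline w t) = vline v t" "vline v t + of_real d = vline w t"
        by (simp_all add: v_def d_def complex_eq_iff)
      show ?thesis
        unfolding Y_def * using \<omega> by (simp add: norm_divide norm_mult)
    qed
    ultimately show "filterlim (\<lambda>t. norm (Y (vline w t))) at_top at_top"
      by simp
  qed
qed

section \<open>Comparison of two L-functions\<close>

text \<open>Both P(u) / u^n and P(v) / v^n tend to the leading coefficient, so it cancels when the
  relation is divided by powers.\<close>

lemma poly_relation_power_quotient:
  fixes u v :: "'a \<Rightarrow> complex"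
  assumes P: "degree P > 0" and c: "c \<noteq> 0"
    and u: "filterlim u at_infinity F" and v: "filterlim v at_infinity F"
    and rel: "\<forall>\<^sub>F t in F. poly P (u t) = c * poly P (v t)"
  shows "((\<lambda>t. (u t / v t) ^ degree P) \<longlongrightarrow> c) F"
proof -
  let ?n = "degree P"
  have l: "lead_coeff P \<noteq> 0"
    using P by auto
  have pu: "((\<lambda>t. poly P (u t) / u t ^ ?n) \<longlongrightarrow> lead_coeff P) F"
    by (rule filterlim_compose[OF poly_divide_tendsto_aux u])
  have pv: "((\<lambda>t. poly P (v t) / v t ^ ?n) \<longlongrightarrow> lead_coeff P) F"
    by (rule filterlim_compose[OF poly_divide_tendsto_aux v])
  have "((\<lambda>t. c * ((poly P (v t) / v t ^ ?n) / (poly P (u t) / u t ^ ?n)))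
      \<longlongrightarrow> c * (lead_coeff P / lead_coeff P)) F"
    by (intro tendsto_intros pu pv l)
  \<comment> \<open>The nonzero limit of P(v) / v^n keeps v and P(v) eventually away from zero,
    hence also P(u), which is c P(v).\<close>
  moreover have "\<forall>\<^sub>F t in F. c * ((poly P (v t) / v t ^ ?n) / (poly P (u t) / u t ^ ?n))
      = (u t / v t) ^ ?n"
    using rel tendsto_imp_eventually_ne[OF pv l] 
  proof eventually_elim
    case (elim t)
    then show ?case
      using c by (simp add: field_simps)
  qed
  ultimately show ?thesis
    using l by (auto intro: Lim_transform_eventually)
qed

text \<open>Poles and limits at z depend only on the punctured neighbourhood. At a common pole both
  values are 0; otherwise both are the common limit.\<close>

lemma nicely_meromorphic_eqI:
  assumes f: "f nicely_meromorphic_on A" and g: "g nicely_meromorphic_on A"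
    and z: "z \<in> A" and eq: "\<forall>\<^sub>F w in at z. f w = g w"
  shows "f z = g z"
proof -
  have pole: "is_pole f z \<longleftrightarrow> is_pole g z"
    using eq by (intro is_pole_cong) auto
  have "(is_pole f z \<and> f z = 0) \<or> f \<midarrow>z\<rightarrow> f z" "(is_pole g z \<and> g z = 0) \<or> g \<midarrow>z\<rightarrow> g z"
    using f g z unfolding nicely_meromorphic_on_def by auto
  moreover have "\<not> (is_pole h z \<and> h \<midarrow>z\<rightarrow> h z)" for h :: "complex \<Rightarrow> complex"
    unfolding is_pole_def using not_tendsto_and_filterlim_at_infinity[OF at_neq_bot] by blast
  moreover have "f \<midarrow>z\<rightarrow> f z \<longleftrightarrow> g \<midarrow>z\<rightarrow> f z"
    by (rule tendsto_cong[OF eq])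
  ultimately show ?thesis
    using pole by (metis LIM_unique)
qed

text \<open>The general \<tau> covers both the limit along a whole vertical line and the limit along
  a sequence of almost periods.\<close>

lemma second_ratio_vline_tendsto:
  assumes "((\<lambda>t. f (vline w (\<tau> t))) \<longlongrightarrow> l) F" "((\<lambda>t. f (vline (w + 1) (\<tau> t))) \<longlongrightarrow> m) F"
    and "((\<lambda>t. f (vline (w + 2) (\<tau> t))) \<longlongrightarrow> n) F" and "m \<noteq> 0"
  shows "((\<lambda>t. second_ratio f (vline w (\<tau> t))) \<longlongrightarrow> n * l / m\<^sup>2) F"
proof -
  have shift: "vline w t + 2 = vline (w + 2) t" "vline w t + 1 = vline (w + 1) t" for t
    by simp_all
  then show ?thesis
    unfolding second_ratio_def shift using assms(4) by (intro tendsto_intros assms(1-3)) auto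
qed

text \<open>A second ratio of 1 makes G(v+k+1) / G(v+k) independent of k; it tends to 1, so it is 1.
  Hence G(w+k) = G(w) for all k, and this tends to 1.\<close>

lemma second_ratio_eq_1_imp_eq_1:
  fixes G :: "complex \<Rightarrow> complex"
  assumes ratio: "\<And>w. Re w \<ge> \<sigma> \<Longrightarrow> second_ratio G w = 1"
    and nz: "\<And>w. Re w \<ge> \<sigma> \<Longrightarrow> G w \<noteq> 0"
    and lim: "(G \<longlongrightarrow> 1) (filtercomap Re at_top)"
    and w: "Re w \<ge> \<sigma>"
  shows "G w = 1"
proof -
  have conv: "(\<lambda>k. G (v + of_nat k)) \<longlonglongrightarrow> 1" for v
  proof (rule filterlim_compose[OF lim])
    have "filterlim (\<lambda>k. Re v + real k) at_top sequentially"
      by (intro filterlim_tendsto_add_at_top[OF tendsto_const filterlim_real_sequentially])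
    then show "filterlim (\<lambda>k. v + of_nat k) (filtercomap Re at_top) sequentially"
      by (simp add: filterlim_filtercomap_iff o_def)
  qed
  have step: "G (v + 1) = G v" if v: "Re v \<ge> \<sigma>" for v
  proof -
    define q where "q = (\<lambda>k::nat. G (v + 1 + of_nat k) / G (v + of_nat k))"
    have "q (Suc k) = q k" for k
    proof -
      have "second_ratio G (v + of_nat k) = 1" "G (v + of_nat k) \<noteq> 0" "G (v + of_nat k + 1) \<noteq> 0"
        using v by (auto intro!: ratio nz)
      then show ?thesis
        by (simp add: q_def second_ratio_def field_simps power2_eq_square)
    qed
    then have "q k = q 0" for k
      by (induction k) auto
    then have "q = (\<lambda>_. q 0)"
      by (rule ext)
    moreover have "q \<longlonglongrightarrow> 1 / 1"
      unfolding q_def by (intro tendsto_divide conv) auto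
    ultimately have "q 0 = 1"
      by (metis LIMSEQ_const_iff div_by_1)
    then show ?thesis
      using nz[OF v] by (simp add: q_def)
  qed
  have "G (w + of_nat k) = G w" for k
  proof (induction k)
    case (Suc k)
    have "G (w + of_nat k + 1) = G (w + of_nat k)"
      using w by (intro step) auto
    then show ?case
      using Suc by (simp add: add_ac)
  qed simp
  then show ?thesis
    using conv[of w] by (simp add: LIMSEQ_const_iff)
qed

theorem mainTheorem5:
  fixes P :: "complex poly" and c :: complex
    and a1 a2 :: "nat \<Rightarrow> complex" and L1 L2 :: "complex \<Rightarrow> complex"
  assumes "degree P > 0" and "rsquarefree P"
    and "extended_selberg a1 L1" and "extended_selberg a2 L2"
    and "\<not> L1 constant_on UNIV" and "\<not> L2 constant_on UNIV"
    and "L_degree L1 > 0" and "L_degree L2 > 0"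
    and "a1 1 = 1" and "a2 1 = 1"
    and "c \<noteq> 0"
    and "\<forall>\<^sub>\<approx>s\<in>UNIV. poly P (L1 s) = c * poly P (L2 s)"
  shows "L1 = L2"
proof -
  note L1 = assms(3) and L2 = assms(4)
  define n where "n = degree P"
  note hol = extended_selberg_holomorphic[OF L1] extended_selberg_holomorphic[OF L2]
  have lim1: "(L1 \<longlongrightarrow> 1) (filtercomap Re at_top)" and lim2: "(L2 \<longlongrightarrow> 1) (filtercomap Re at_top)"
    using extended_selberg_tendsto_first_coeff[OF L1] extended_selberg_tendsto_first_coeff[OF L2]
      assms(9,10) by auto
  have cont: "isCont L1 s" "isCont L2 s" if "s \<noteq> 1" for s
    using hol[THEN holomorphic_on_imp_continuous_on] that
    by (auto simp: continuous_on_eq_continuous_at open_Compl)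
  have rel: "poly P (L1 s) = c * poly P (L2 s)" if "s \<noteq> 1" for s
  proof -
    have "isCont (\<lambda>s. poly P (L1 s)) s" "isCont (\<lambda>s. c * poly P (L2 s)) s"
      using cont[OF that] isCont_o2[OF _ poly_isCont] by (auto intro!: isCont_mult)
    moreover have "\<forall>\<^sub>F s in at s. poly P (L1 s) = c * poly P (L2 s)"
      using assms(12) by (rule eventually_cosparse_imp_eventually_at) simp
    ultimately show ?thesis
      by (rule isCont_eventually_eq)
  qed
  obtain Y1 \<sigma>1 where
    Y1: "\<And>w. \<forall>\<^sub>F t in at_top. cnj (L1 (1 - cnj (vline w t))) = Y1 (vline w t) * L1 (vline w t)"
      "\<And>w. ((\<lambda>t. second_ratio Y1 (vline w t)) \<longlongrightarrow> 1) at_top"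
      "\<And>w. Re w \<ge> \<sigma>1 \<Longrightarrow> filterlim (\<lambda>t. norm (Y1 (vline w t))) at_top at_top"
    by (rule reflection_factor_exists[OF L1 assms(7)]) blast
  obtain Y2 \<sigma>2 where
    Y2: "\<And>w. \<forall>\<^sub>F t in at_top. cnj (L2 (1 - cnj (vline w t))) = Y2 (vline w t) * L2 (vline w t)"
      "\<And>w. ((\<lambda>t. second_ratio Y2 (vline w t)) \<longlongrightarrow> 1) at_top"
      "\<And>w. Re w \<ge> \<sigma>2 \<Longrightarrow> filterlim (\<lambda>t. norm (Y2 (vline w t))) at_top at_top"
    by (rule reflection_factor_exists[OF L2 assms(8)]) blast
  have "\<forall>\<^sub>F s in filtercomap Re at_top. norm (L1 s) > 1 / 2 \<and> norm (L2 s) > 1 / 2"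
    by (intro eventually_conj order_tendstoD(1)[OF tendsto_norm[OF lim1]]
        order_tendstoD(1)[OF tendsto_norm[OF lim2]]) auto
  then obtain \<sigma>3 where \<sigma>3: "\<And>s. Re s \<ge> \<sigma>3 \<Longrightarrow> norm (L1 s) > 1 / 2 \<and> norm (L2 s) > 1 / 2"
    by (auto simp: eventually_filtercomap_at_top_linorder)
  \<comment> \<open>The entry 2 ensures absolute convergence for Re w \<ge> \<sigma> and puts the
    reflected points at real part at most -1, away from the possible pole.\<close>
  define \<sigma> where "\<sigma> = Max {\<sigma>1, \<sigma>2, \<sigma>3, 2}"
  have \<sigma>: "\<sigma> \<ge> \<sigma>1" "\<sigma> \<ge> \<sigma>2" "\<sigma> \<ge> \<sigma>3" "\<sigma> \<ge> 2"
    by (simp_all add: \<sigma>_def)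
  have L_large: "norm (L1 s) > 1 / 2" "norm (L2 s) > 1 / 2" if "Re s \<ge> \<sigma>" for s
    using \<sigma>3[of s] \<sigma>(3) that by auto
  have L_nz: "L1 s \<noteq> 0" "L2 s \<noteq> 0" if "Re s \<ge> \<sigma>" for s
    using L_large[OF that] by auto
  have reflected_large: "filterlim (\<lambda>t. L (1 - cnj (vline w t))) at_infinity at_top"
    if Y: "\<forall>\<^sub>F t in at_top. cnj (L (1 - cnj (vline w t))) = Y (vline w t) * L (vline w t)"
      and lim: "filterlim (\<lambda>t. norm (Y (vline w t))) at_top at_top"
      and large: "\<And>t. norm (L (vline w t)) > 1 / 2"
    for L Y :: "complex \<Rightarrow> complex" and w
  proof (rule filterlim_norm_at_top_imp_at_infinity, rule filterlim_at_top_mono)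
    show "filterlim (\<lambda>t. 1 / 2 * norm (Y (vline w t))) at_top at_top"
      by (rule filterlim_tendsto_pos_mult_at_top[OF tendsto_const _ lim]) simp
    show "\<forall>\<^sub>F t in at_top. 1 / 2 * norm (Y (vline w t)) \<le> norm (L (1 - cnj (vline w t)))"
      using Y
    proof eventually_elim
      case (elim t)
      have "norm (L (1 - cnj (vline w t))) = norm (Y (vline w t) * L (vline w t))"
        by (simp only: elim[symmetric] complex_mod_cnj)
      then show ?case
        using mult_left_mono[OF less_imp_le[OF large[of t]], of "norm (Y (vline w t))"]
        by (simp add: norm_mult)
    qed
  qed
  \<comment> \<open>By the functional equations, high up on a vertical line this is the conjugate of
    (L1/L2)^n at the reflected point, where both functions are large.\<close>
  define R where "R = (\<lambda>w. ((Y1 w * L1 w) / (Y2 w * L2 w)) ^ n)"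
  have R_lim: "((\<lambda>t. R (vline w t)) \<longlongrightarrow> cnj c) at_top" if w: "Re w \<ge> \<sigma>" for w
  proof -
    let ?s = "\<lambda>t. 1 - cnj (vline w t)"
    have "((\<lambda>t. cnj ((L1 (?s t) / L2 (?s t)) ^ n)) \<longlongrightarrow> cnj c) at_top"
      unfolding n_def
    proof (intro tendsto_cnj poly_relation_power_quotient assms(1,11))
      show "filterlim (\<lambda>t. L1 (?s t)) at_infinity at_top"
        by (rule reflected_large[OF Y1(1) Y1(3)]) (use w \<sigma> L_large in auto)
      show "filterlim (\<lambda>t. L2 (?s t)) at_infinity at_top"
        by (rule reflected_large[OF Y2(1) Y2(3)]) (use w \<sigma> L_large in auto)
      have "?s t \<noteq> 1" for t
        using w \<sigma> by (auto simp: complex_eq_iff)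
      then show "\<forall>\<^sub>F t in at_top. poly P (L1 (?s t)) = c * poly P (L2 (?s t))"
        by (simp add: rel)
    qed
    moreover have "\<forall>\<^sub>F t in at_top. cnj ((L1 (?s t) / L2 (?s t)) ^ n) = R (vline w t)"
      using Y1(1)[of w] Y2(1)[of w]
    proof eventually_elim
      case (elim t)
      then show ?case
        unfolding R_def by (simp only: complex_cnj_power complex_cnj_divide)
    qed
    ultimately show ?thesis
      by (rule Lim_transform_eventually)
  qed
  define G where "G = (\<lambda>w. (L1 w / L2 w) ^ n)"
  \<comment> \<open>\<open>R\<close> is \<open>G\<close> times (Y1/Y2)^n. The second ratio of
    \<open>R\<close> tends to 1 since the nonzero limit \<open>cnj c\<close> cancels, and that of
    the Y-part tends to 1 by reflection.\<close>
  have G_vline: "((\<lambda>t. second_ratio G (vline w t)) \<longlongrightarrow> 1) at_top" if w: "Re w \<ge> \<sigma>" for w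
  proof -
    let ?Y = "\<lambda>w. (Y1 w / Y2 w) ^ n"
    have "((\<lambda>t. second_ratio R (vline w t)) \<longlongrightarrow> cnj c * cnj c / (cnj c)\<^sup>2) at_top"
      using w assms(11) by (intro second_ratio_vline_tendsto R_lim) auto
    then have Rlim: "((\<lambda>t. second_ratio R (vline w t)) \<longlongrightarrow> 1) at_top"
      using assms(11) by (simp add: power2_eq_square)
    have "((\<lambda>t. (second_ratio Y1 (vline w t) / second_ratio Y2 (vline w t)) ^ n) \<longlongrightarrow> (1 / 1) ^ n) at_top"
      by (intro tendsto_intros Y1 Y2) auto
    then have Ylim: "((\<lambda>t. second_ratio ?Y (vline w t)) \<longlongrightarrow> 1) at_top"
      by (simp add: second_ratio_power second_ratio_divide)
    have "second_ratio R v = second_ratio ?Y v * second_ratio G v" for v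
      by (simp add: R_def G_def second_ratio_power second_ratio_divide second_ratio_mult
          power_mult_distrib power_divide)
    moreover have "\<forall>\<^sub>F t in at_top. second_ratio ?Y (vline w t) \<noteq> 0"
      by (rule tendsto_imp_eventually_ne[OF Ylim]) simp
    ultimately have "\<forall>\<^sub>F t in at_top. second_ratio R (vline w t) / second_ratio ?Y (vline w t)
        = second_ratio G (vline w t)"
      by (auto elim: eventually_mono)
    with tendsto_divide[OF Rlim Ylim] show ?thesis
      by (auto intro: Lim_transform_eventually)
  qed
  \<comment> \<open>Along almost periods the second ratio of \<open>G\<close> returns to its value
    at w, while it also tends to 1 up the line.\<close>
  have G_ratio: "second_ratio G w = 1" if w: "Re w \<ge> \<sigma>" for w
  proof -
    obtain \<tau> :: "nat \<Rightarrow> real" where \<tau>: "filterlim \<tau> at_top sequentially"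
      "\<And>n. n > 0 \<Longrightarrow> (\<lambda>j. of_nat n powr (- (\<i> * of_real (\<tau> j))) :: complex) \<longlonglongrightarrow> 1"
      by (rule simultaneous_almost_period) blast
    have Glim: "(\<lambda>j. G (vline v (\<tau> j))) \<longlonglongrightarrow> G v" if "Re v \<ge> \<sigma>" for v
      unfolding G_def using that \<sigma> L_nz
      by (intro tendsto_intros extended_selberg_almost_period[OF L1]
          extended_selberg_almost_period[OF L2] \<tau>(2)) auto
    have "G (w + 1) \<noteq> 0"
      using w L_nz by (simp add: G_def)
    then have "(\<lambda>j. second_ratio G (vline w (\<tau> j))) \<longlonglongrightarrow> second_ratio G w"
      unfolding second_ratio_def[of G w]
      using w by (intro second_ratio_vline_tendsto Glim) auto
    moreover have "(\<lambda>j. second_ratio G (vline w (\<tau> j))) \<longlonglongrightarrow> 1"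
      by (rule filterlim_compose[OF G_vline[OF w] \<tau>(1)])
    ultimately show ?thesis
      by (rule LIMSEQ_unique)
  qed
  have G_lim: "(G \<longlongrightarrow> 1) (filtercomap Re at_top)"
    unfolding G_def using tendsto_power[OF tendsto_divide[OF lim1 lim2], of n] by simp
  have G_1: "(L1 w / L2 w) ^ n = 1" if "Re w \<ge> \<sigma>" for w
    using second_ratio_eq_1_imp_eq_1[OF G_ratio _ G_lim that] L_nz by (auto simp: G_def)

  \<comment> \<open>From equal powers to equal functions\<close>
  define S where "S = {s. Re s > \<sigma>}"
  \<comment> \<open>A continuous function on a connected set with values among the n-th roots of
    unity is constant.\<close>
  have "(\<lambda>s. L1 s / L2 s) constant_on S"
  proof (rule continuous_finite_range_constant)
    show "connected S"
      unfolding S_def by (rule connected_halfspace_Re_gt)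
    show "continuous_on S (\<lambda>s. L1 s / L2 s)"
      using \<sigma> L_nz by (intro continuous_at_imp_continuous_on ballI continuous_intros cont)
        (auto simp: S_def)
    have "finite {z :: complex. z ^ n = 1}"
      using assms(1) by (intro finite_roots_unity) (auto simp: n_def)
    then show "finite ((\<lambda>s. L1 s / L2 s) ` S)"
      by (rule finite_subset[rotated]) (use G_1 in \<open>auto simp: S_def\<close>)
  qed
  then obtain k where k: "\<And>s. s \<in> S \<Longrightarrow> L1 s / L2 s = k"
    by (auto simp: constant_on_def)
  \<comment> \<open>The normalisation a(1) = 1 of both series singles out the root of unity
    1.\<close>
  have "((\<lambda>s. L1 s / L2 s) \<longlongrightarrow> 1 / 1) (filtercomap Re at_top)"
    by (intro tendsto_divide lim1 lim2) auto
  moreover have "\<forall>\<^sub>F s in filtercomap Re at_top. L1 s / L2 s = k"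
    unfolding eventually_filtercomap_at_top_dense using k by (auto simp: S_def)
  then have "((\<lambda>s. L1 s / L2 s) \<longlongrightarrow> k) (filtercomap Re at_top)"
    by (rule tendsto_eventually)
  ultimately have "k = 1"
    using tendsto_unique[OF filtercomap_Re_at_top_neq_bot] by fastforce
  then have eqS: "L1 s = L2 s" if "s \<in> S" for s
    using k[OF that] L_nz[of s] that by (auto simp: S_def)
  have eq: "L1 s = L2 s" if "s \<noteq> 1" for s
  proof (rule analytic_continuation_open[of S "- {1}" L1 L2])
    show "open S"
      unfolding S_def by (rule open_halfspace_Re_gt)
    show "S \<noteq> {}"
      by (auto simp: S_def intro!: exI[of _ "of_real (\<sigma> + 1)"])
    show "connected (- {1 :: complex})"
      unfolding Compl_eq_Diff_UNIV by (intro connected_open_delete) auto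
    show "S \<subseteq> - {1}"
      using \<sigma> by (auto simp: S_def)
  qed (use hol that eqS in auto)
  \<comment> \<open>The identity theorem does not reach the possible pole; the value there is fixed
    by nice meromorphy.\<close>
  moreover have "L1 1 = L2 1"
  proof (rule nicely_meromorphic_eqI[of L1 UNIV L2 1])
    show "L1 nicely_meromorphic_on UNIV" "L2 nicely_meromorphic_on UNIV"
      using L1 L2 by (auto simp: extended_selberg_def)
    show "\<forall>\<^sub>F s in at 1. L1 s = L2 s"
      using eq by (auto simp: eventually_at_filter)
  qed auto
  ultimately show ?thesis
    by (metis ext)
qed

end
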